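(* Fix a finite horizon $T$ and a deterministic positive boundary template $g=(g_0,\ldots,g_T)$. Define the aspect ratio $$K_g:=\frac{\max_{0\le t\le T}g_t}{\min_{0\le t\le T}g_t}.$$ For $0<\gamma<1$ and $\eta>0$, $$P\Big\{\max_{0\le t\le T}\widehat q_\alpha(g)\,g_t<K_g\,s_{\alpha-\eta,T}\Big\}\ge 1-\exp\Big[-2B\Big(\eta-\frac{1-\alpha}{B}\Big)_+^2\Big],$$ where $s_{\gamma,T}:=\inf\{s>0:P_0(S_T\ge s)\le\gamma\}$. Consequently, with the same probability, $$\frac{\max_{0\le t\le T}\widehat q_\alpha(g)\,g_t}{1/\alpha}\le \alpha K_g\,s_{\alpha-\eta,T}.$$
   Context: $(M_t)_{0\le t\le T}$ is an e-process under the null distribution $P_0$ (a nonnegative adapted process with $\mathbb E_{P_0}[M_\sigma]\le1$ for all stopping times $\sigma$), $S_T:=\max_{0\le t\le T}M_t$ is its path maximum, and $\alpha\in(0,1)$ is a significance level. The template $g$ is specified independently of the calibration trajectories. $(M_t^{(b)})_{0\le t\le T}$, $b=1,\ldots,B$, are $B$ independent reference-null trajectories of this e-process, generated under $P_0$. Let $R_g^{(b)}:=\max_{0\le t\le T}M^{(b)}_t/g_t$ be their normalized path maxima, with order statistics $R_{g,(1)}\le\cdots\le R_{g,(B)}$ and the convention $R_{g,(B+1)}:=+\infty$. The calibrated multiplier is $\widehat q_\alpha(g):=R_{g,(k_{\alpha,B})}$ with $k_{\alpha,B}:=\lceil(1-\alpha)(B+1)\rceil$. $P$ is the probability over the reference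 trajectories, and $(x)_+:=\max(x,0)$.
   Formalization: The strict first bound is proved only if P_0(S_T ≥ s_{α-η,T}) ≤ α-η (infimum attained); it fails otherwise, e.g. for M_t = g_t = 1. The second, non-strict bound is proved without this condition; the level α-η is taken in (0,1). *)

theory Defs
  imports "HOL-Probability.Probability"
begin

text \<open>The horizon is \<open>T\<close>. Processes, templates and filtrations are indexed by all of
  \<open>nat\<close>, but processes and templates are only looked at on the times \<open>{0..T}\<close>.
  A filtration on \<open>{0..T}\<close> extends to \<open>nat\<close> by keeping it constant after \<open>T\<close>; stopping times
  take values in \<open>{0..T}\<close>.\<close>

definition e_process ::
  "'a measure \<Rightarrow> (nat \<Rightarrow> 'a measure) \<Rightarrow> nat \<Rightarrow> (nat \<Rightarrow> 'a \<Rightarrow> real) \<Rightarrow> bool" where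
  "e_process P0 F T M \<longleftrightarrow>
     prob_space P0 \<and>
     filtration (space P0) F \<and> (\<forall>t. subalgebra P0 (F t)) \<and>
     (\<forall>t\<le>T. M t \<in> borel_measurable (F t)) \<and>
     (\<forall>t\<le>T. \<forall>\<omega>\<in>space P0. 0 \<le> M t \<omega>) \<and>
     (\<forall>\<sigma>. stopping_time F \<sigma> \<and> (\<forall>\<omega>\<in>space P0. \<sigma> \<omega> \<le> T) \<longrightarrow>
        (\<integral>\<^sup>+\<omega>. ennreal (M (\<sigma> \<omega>) \<omega>) \<partial>P0) \<le> 1)"

definition path_max :: "nat \<Rightarrow> (nat \<Rightarrow> 'a \<Rightarrow> real) \<Rightarrow> 'a \<Rightarrow> real" where
  "path_max T M \<omega> = Max ((\<lambda>t. M t \<omega>) ` {0..T})"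

text \<open>The infimum is over a nonempty set bounded below whenever \<open>0 < \<gamma>\<close>, so it is
  not affected by the default value of \<open>Inf\<close>. It need not be a minimum: if the path maximum has
  an atom at the infimum, then its upper tail there, with \<open>\<ge>\<close>, can exceed \<open>\<gamma>\<close>. For
  instance, if the path maximum is constantly \<open>1\<close>, the set is \<open>{1<..}\<close>.\<close>

definition null_quantile :: "'a measure \<Rightarrow> nat \<Rightarrow> (nat \<Rightarrow> 'a \<Rightarrow> real) \<Rightarrow> real \<Rightarrow> real" where
  "null_quantile P0 T M \<gamma> =
     Inf {s. 0 < s \<and> measure P0 {\<omega> \<in> space P0. path_max T M \<omega> \<ge> s} \<le> \<gamma>}"

definition aspect_ratio :: "nat \<Rightarrow> (nat \<Rightarrow> real) \<Rightarrow> real" where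
  "aspect_ratio T g = Max (g ` {0..T}) / Min (g ` {0..T})"

definition path_space :: "nat \<Rightarrow> (nat \<Rightarrow> real) measure" where
  "path_space T = (\<Pi>\<^sub>M t\<in>{0..T}. borel)"

definition path :: "nat \<Rightarrow> (nat \<Rightarrow> 'a \<Rightarrow> real) \<Rightarrow> 'a \<Rightarrow> (nat \<Rightarrow> real)" where
  "path T M \<omega> = (\<lambda>t\<in>{0..T}. M t \<omega>)"

text \<open>\<open>X b t\<close>, \<open>b = 1, \<dots>, B\<close>, are independent trajectories on the probability space \<open>P\<close>,
  each with the law that the whole path \<open>M\<close> has under \<open>P0\<close>.\<close>

definition reference_trajectories ::
  "'a measure \<Rightarrow> nat \<Rightarrow> (nat \<Rightarrow> 'a \<Rightarrow> real) \<Rightarrow>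
   'b measure \<Rightarrow> nat \<Rightarrow> (nat \<Rightarrow> nat \<Rightarrow> 'b \<Rightarrow> real) \<Rightarrow> bool" where
  "reference_trajectories P0 T M P B X \<longleftrightarrow>
     prob_space P \<and>
     prob_space.indep_vars P (\<lambda>_. path_space T) (\<lambda>b. path T (X b)) {1..B} \<and>
     (\<forall>b\<in>{1..B}. distr P (path_space T) (path T (X b)) = distr P0 (path_space T) (path T M))"

definition normalized_max ::
  "nat \<Rightarrow> (nat \<Rightarrow> real) \<Rightarrow> (nat \<Rightarrow> nat \<Rightarrow> 'b \<Rightarrow> real) \<Rightarrow> nat \<Rightarrow> 'b \<Rightarrow> real" where
  "normalized_max T g X b \<omega> = Max ((\<lambda>t. X b t \<omega> / g t) ` {0..T})"

text \<open>The \<open>k\<close>-th smallest of \<open>R 1, \<dots>, R B\<close> (counted with multiplicity, \<open>k \<ge> 1\<close>), and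
  \<open>\<infinity>\<close> for \<open>k = B + 1\<close>.\<close>

definition order_stat :: "nat \<Rightarrow> (nat \<Rightarrow> real) \<Rightarrow> nat \<Rightarrow> ereal" where
  "order_stat B R k = (if k \<le> B then ereal (sort (map R [1..<Suc B]) ! (k - 1)) else \<infinity>)"

definition calib_index :: "real \<Rightarrow> nat \<Rightarrow> nat" where
  "calib_index \<alpha> B = nat \<lceil>(1 - \<alpha>) * (real B + 1)\<rceil>"

definition calib_mult ::
  "real \<Rightarrow> nat \<Rightarrow> nat \<Rightarrow> (nat \<Rightarrow> real) \<Rightarrow> (nat \<Rightarrow> nat \<Rightarrow> 'b \<Rightarrow> real) \<Rightarrow> 'b \<Rightarrow> ereal" where
  "calib_mult \<alpha> T B g X \<omega> =
     order_stat B (\<lambda>b. normalized_max T g X b \<omega>) (calib_index \<alpha> B)"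

definition max_calib_boundary ::
  "real \<Rightarrow> nat \<Rightarrow> nat \<Rightarrow> (nat \<Rightarrow> real) \<Rightarrow> (nat \<Rightarrow> nat \<Rightarrow> 'b \<Rightarrow> real) \<Rightarrow> 'b \<Rightarrow> ereal" where
  "max_calib_boundary \<alpha> T B g X \<omega> =
     Max ((\<lambda>t. calib_mult \<alpha> T B g X \<omega> * ereal (g t)) ` {0..T})"

end

theory Submission
  imports Defs
begin

text \<open>Let \<open>s\<close> be the null quantile and \<open>m\<close> the minimum of the template. If the largest calibrated
  boundary value reaches \<open>aspect_ratio T g * s\<close>, then the order statistic is at least \<open>s / m\<close>, so
  \<open>B + 1 - calib_index \<alpha> B\<close> of the trajectories have a normalized maximum of at least \<open>s / m\<close>, and hence
  a path maximum of at least \<open>s\<close>. The number of such trajectories is a sum of independent indicators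
  with mean at most \<open>B * (\<alpha> - \<eta>)\<close>, and Hoeffding's inequality applies. Where the threshold is
  exceeded strictly, the tail is the open one \<open>{s<..}\<close>, whose mass is at most \<open>\<alpha> - \<eta>\<close> even if the
  quantile is not attained.\<close>

section \<open>Order statistics and counting\<close>

text \<open>As \<open>Q\<close> is closed downwards, the entries satisfying it form an initial
  segment of the sorted list. A general \<open>Q\<close> covers both \<open>x \<le> a\<close> and
  \<open>x < c\<close>.\<close>

lemma sorted_nth_iff_length_filter:
  fixes xs :: "'a :: linorder list"
  assumes "sorted xs" "0 < k" "k \<le> length xs"
    and Q: "\<And>x y. x \<le> y \<Longrightarrow> Q y \<Longrightarrow> Q x"
  shows "Q (xs ! (k - 1)) \<longleftrightarrow> k \<le> length (filter Q xs)"
proof -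
  let ?I = "{i. i < length xs \<and> Q (xs ! i)}"
  show ?thesis
  proof
    assume "Q (xs ! (k - 1))"
    moreover have "xs ! i \<le> xs ! (k - 1)" if "i < k" for i
      using that assms(2,3) by (intro sorted_nth_mono[OF assms(1)]) auto
    ultimately have "{..<k} \<subseteq> ?I"
      using assms(3) Q by fastforce
    then have "card {..<k} \<le> card ?I"
      by (intro card_mono) auto
    then show "k \<le> length (filter Q xs)"
      by (simp add: length_filter_conv_card)
  next
    assume le: "k \<le> length (filter Q xs)"
    show "Q (xs ! (k - 1))"
    proof (rule ccontr)
      assume n: "\<not> Q (xs ! (k - 1))"
      have "?I \<subseteq> {..<k - 1}"
      proof
        fix i assume i: "i \<in> ?I"
        show "i \<in> {..<k - 1}"
        proof (rule ccontr)
          assume "i \<notin> {..<k - 1}"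
          then have "xs ! (k - 1) \<le> xs ! i"
            using i by (intro sorted_nth_mono[OF assms(1)]) auto
          then show False using Q i n by auto
        qed
      qed
      then have "card ?I \<le> card {..<k - 1}"
        by (intro card_mono) auto
      then show False
        using le \<open>0 < k\<close> by (simp add: length_filter_conv_card)
    qed
  qed
qed

text \<open>Sorting keeps the multiset of values, and counting indices instead of values accounts
  for ties.\<close>

lemma sort_nth_iff_card:
  fixes R :: "nat \<Rightarrow> 'a :: linorder"
  assumes "0 < k" "k \<le> B" and Q: "\<And>x y. x \<le> y \<Longrightarrow> Q y \<Longrightarrow> Q x"
  shows "Q (sort (map R [1..<Suc B]) ! (k - 1)) \<longleftrightarrow> k \<le> card {b \<in> {1..B}. Q (R b)}"
proof -
  let ?xs = "map R [1..<Suc B]"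
  have "length (filter Q (sort ?xs)) = size (filter_mset Q (mset (sort ?xs)))"
    by (metis mset_filter size_mset)
  also have "\<dots> = length (filter Q ?xs)"
    by (metis mset_filter size_mset mset_sort)
  also have "\<dots> = card (set (filter (\<lambda>b. Q (R b)) [1..<Suc B]))"
    by (subst distinct_card) (simp_all add: filter_map comp_def del: upt_Suc)
  also have "set (filter (\<lambda>b. Q (R b)) [1..<Suc B]) = {b \<in> {1..B}. Q (R b)}"
    by auto
  finally show ?thesis
    using sorted_nth_iff_length_filter[of "sort ?xs" k Q] assms by (auto simp del: upt_Suc)
qed

text \<open>The \<open>k\<close>-th smallest value is at most \<open>a\<close> exactly when at least
  \<open>k\<close> of the values are, and this count is a sum of measurable indicators.\<close>

lemma borel_measurable_sort_nth:
  fixes R :: "nat \<Rightarrow> 'a \<Rightarrow> real"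
  assumes "0 < k" "k \<le> B" and [measurable]: "\<And>b. b \<in> {1..B} \<Longrightarrow> R b \<in> borel_measurable N"
  shows "(\<lambda>\<omega>. sort (map (\<lambda>b. R b \<omega>) [1..<Suc B]) ! (k - 1)) \<in> borel_measurable N"
proof (rule borel_measurableI_le)
  fix a
  have "{\<omega> \<in> space N. sort (map (\<lambda>b. R b \<omega>) [1..<Suc B]) ! (k - 1) \<le> a}
      = {\<omega> \<in> space N. real k \<le> (\<Sum>b\<in>{1..B}. indicator {..a} (R b \<omega>))}"
    using sort_nth_iff_card[OF assms(1,2), of "\<lambda>x. x \<le> a"]
    by (auto simp: sum.If_cases indicator_def Int_def simp del: upt_Suc)
  also have "\<dots> \<in> sets N"
    by measurable
  finally show "{\<omega> \<in> space N. sort (map (\<lambda>b. R b \<omega>) [1..<Suc B]) ! (k - 1) \<le> a} \<in> sets N" .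
qed

lemma borel_measurable_Max_image:
  fixes f :: "'i \<Rightarrow> 'a \<Rightarrow> real"
  assumes "finite I" "I \<noteq> {}" "\<And>i. i \<in> I \<Longrightarrow> f i \<in> borel_measurable N"
  shows "(\<lambda>\<omega>. Max ((\<lambda>i. f i \<omega>) ` I)) \<in> borel_measurable N"
proof (rule borel_measurableI_le)
  fix a
  have "{\<omega> \<in> space N. Max ((\<lambda>i. f i \<omega>) ` I) \<le> a} = {\<omega> \<in> space N. \<forall>i\<in>I. f i \<omega> \<le> a}"
    using assms by auto
  also have "\<dots> \<in> sets N"
    using assms by (intro sets.sets_Collect_finite_All) auto
  finally show "{\<omega> \<in> space N. Max ((\<lambda>i. f i \<omega>) ` I) \<le> a} \<in> sets N" .
qed

section \<open>Tail quantiles and concentration\<close>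

context prob_space
begin

text \<open>\<open>Y\<close> is real-valued, so the events \<open>real n \<le> Y \<omega>\<close>
  decrease to the empty set. This makes the set under the infimum of a quantile nonempty.\<close>

lemma ex_prob_upper_tail_le:
  fixes Y :: "'a \<Rightarrow> real"
  assumes [measurable]: "random_variable borel Y" and "0 < \<gamma>"
  shows "\<exists>s>0. prob {\<omega> \<in> space M. s \<le> Y \<omega>} \<le> \<gamma>"
proof -
  let ?A = "\<lambda>n::nat. {\<omega> \<in> space M. real n \<le> Y \<omega>}"
  have "(\<lambda>n. prob (?A n)) \<longlonglongrightarrow> prob (\<Inter>n. ?A n)"
    by (intro finite_Lim_measure_decseq) (auto simp: decseq_def)
  also have "(\<Inter>n. ?A n) = {}"
  proof -
    have "\<exists>n. \<omega> \<notin> ?A n" for \<omega>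
      using reals_Archimedean2[of "Y \<omega>"] by (auto simp: not_le)
    then show ?thesis by blast
  qed
  finally have "(\<lambda>n. prob (?A n)) \<longlonglongrightarrow> 0"
    by simp
  then have "\<forall>\<^sub>F n in sequentially. prob (?A n) < \<gamma> \<and> 0 < n"
    using \<open>0 < \<gamma>\<close> by (intro eventually_conj order_tendstoD(2) eventually_gt_at_top)
  then obtain n where "prob (?A n) < \<gamma>" "0 < n"
    by (auto simp: eventually_sequentially)
  then show ?thesis
    by (intro exI[of _ "real n"]) auto
qed

text \<open>Every level above the infimum exceeds some member of the set, so its closed tail is
  small. The open tail at \<open>s\<close> is an increasing union of such closed tails.\<close>

lemma prob_greater_Inf_upper_tail_le:
  fixes Y :: "'a \<Rightarrow> real"
  assumes Y [measurable]: "random_variable borel Y" and "0 < \<gamma>"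
  defines "s \<equiv> Inf {s. 0 < s \<and> prob {\<omega> \<in> space M. s \<le> Y \<omega>} \<le> \<gamma>}"
  shows "prob {\<omega> \<in> space M. s < Y \<omega>} \<le> \<gamma>"
proof -
  let ?S = "{s. 0 < s \<and> prob {\<omega> \<in> space M. s \<le> Y \<omega>} \<le> \<gamma>}"
  let ?A = "\<lambda>n::nat. {\<omega> \<in> space M. s + 1 / real (Suc n) \<le> Y \<omega>}"
  have "prob (?A n) \<le> \<gamma>" for n
  proof -
    have "Inf ?S < s + 1 / real (Suc n)"
      by (simp add: s_def)
    \<comment> \<open>The real infimum is approached by members only of a nonempty set that is
      bounded below, here by \<open>0\<close>.\<close>
    then obtain r where r: "r \<in> ?S" "r < s + 1 / real (Suc n)"
      using ex_prob_upper_tail_le[OF Y \<open>0 < \<gamma>\<close>] by (subst (asm) cInf_less_iff) (auto intro: bdd_belowI[of _ 0])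
    have "prob (?A n) \<le> prob {\<omega> \<in> space M. r \<le> Y \<omega>}"
      using r by (intro finite_measure_mono) auto
    then show ?thesis using r by simp
  qed
  moreover have "(\<lambda>n. prob (?A n)) \<longlonglongrightarrow> prob (\<Union>n. ?A n)"
  proof (intro finite_Lim_measure_incseq)
    show "incseq ?A"
    proof (intro monoI subsetI)
      fix m n :: nat and \<omega> assume "m \<le> n" and \<omega>: "\<omega> \<in> ?A m"
      then have "1 / real (Suc n) \<le> 1 / real (Suc m)"
        by (intro divide_left_mono) auto
      with \<omega> show "\<omega> \<in> ?A n" by auto
    qed
  qed auto
  moreover have "(\<Union>n. ?A n) = {\<omega> \<in> space M. s < Y \<omega>}"
  proof (intro set_eqI iffI)
    fix \<omega> assume "\<omega> \<in> (\<Union>n. ?A n)"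
    then obtain n where n: "\<omega> \<in> space M" "s + 1 / real (Suc n) \<le> Y \<omega>" by auto
    moreover have "0 < 1 / real (Suc n)" by simp
    ultimately have "s < Y \<omega>" by linarith
    with n show "\<omega> \<in> {\<omega> \<in> space M. s < Y \<omega>}" by simp
  next
    fix \<omega> assume \<omega>: "\<omega> \<in> {\<omega> \<in> space M. s < Y \<omega>}"
    then obtain n where "inverse (real (Suc n)) < Y \<omega> - s"
      using reals_Archimedean[of "Y \<omega> - s"] by auto
    then show "\<omega> \<in> (\<Union>n. ?A n)"
      using \<omega> by (auto intro!: exI[of _ n] simp: inverse_eq_divide)
  qed
  ultimately show ?thesis
    by (auto intro: LIMSEQ_le_const2)
qed

text \<open>The count is a sum of independent indicators with mean at most
  \<open>real (card I) * p\<close>, so the event forces an excess of at least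
  \<open>real (card I) * \<delta>\<close> over the mean.\<close>

lemma Hoeffding_card_ge:
  fixes Y :: "'i \<Rightarrow> 'a \<Rightarrow> real"
  assumes "finite I" "I \<noteq> {}" and indep: "indep_vars (\<lambda>_. borel) Y I"
    and [measurable]: "A \<in> sets borel"
    and tail: "\<And>i. i \<in> I \<Longrightarrow> prob {\<omega> \<in> space M. Y i \<omega> \<in> A} \<le> p" and "0 \<le> \<delta>"
  shows "prob {\<omega> \<in> space M. real (card I) * (p + \<delta>) \<le> real (card {i \<in> I. Y i \<omega> \<in> A})}
           \<le> exp (- 2 * real (card I) * \<delta>\<^sup>2)"
proof -
  define Z where "Z = (\<lambda>i \<omega>. indicator A (Y i \<omega>) :: real)"
  have Y [measurable]: "i \<in> I \<Longrightarrow> random_variable borel (Y i)" for i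
    using indep by (auto simp: indep_vars_def)
  have indepZ: "indep_vars (\<lambda>_. borel) Z I"
    unfolding Z_def by (rule indep_vars_compose2[OF indep]) auto
  define \<mu> where "\<mu> = (\<Sum>i\<in>I. expectation (Z i))"
  interpret Hoeffding_ineq M I Z "\<lambda>_. 0" "\<lambda>_. 1" \<mu>
    by unfold_locales (use \<open>finite I\<close> indepZ in \<open>auto simp: \<mu>_def Z_def indicator_def\<close>)
  have "expectation (Z i) \<le> p" if "i \<in> I" for i
  proof -
    have "expectation (Z i) = expectation (indicator {\<omega> \<in> space M. Y i \<omega> \<in> A})"
      by (intro Bochner_Integration.integral_cong) (auto simp: Z_def indicator_def)
    also have "\<dots> = prob {\<omega> \<in> space M. Y i \<omega> \<in> A}"
      by (simp add: Int_def conj_commute)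
    finally show ?thesis using tail[OF that] by simp
  qed
  then have \<mu>: "\<mu> \<le> real (card I) * p"
    unfolding \<mu>_def by (rule sum_bounded_above)
  have card: "0 < card I"
    using assms by (simp add: card_gt_0_iff)
  have sumZ: "(\<Sum>i\<in>I. Z i \<omega>) = real (card {i \<in> I. Y i \<omega> \<in> A})" for \<omega>
    using \<open>finite I\<close> by (simp add: Z_def indicator_def sum.If_cases Int_def)
  have Zm [measurable]: "i \<in> I \<Longrightarrow> random_variable borel (Z i)" for i
    using indepZ by (auto simp: indep_vars_def)
  have "prob {\<omega> \<in> space M. real (card I) * (p + \<delta>) \<le> (\<Sum>i\<in>I. Z i \<omega>)}
      \<le> prob {\<omega> \<in> space M. (\<Sum>i\<in>I. Z i \<omega>) \<ge> \<mu> + real (card I) * \<delta>}"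
    using \<mu> by (intro finite_measure_mono) (auto simp: distrib_left)
  also have "\<dots> \<le> exp (- 2 * (real (card I) * \<delta>)\<^sup>2 / (\<Sum>i\<in>I. (1 - 0)\<^sup>2))"
    using \<open>0 \<le> \<delta>\<close> card by (intro Hoeffding_ineq_ge) auto
  \<comment> \<open>Each indicator has range length 1, so the denominator is \<open>card I\<close>
    and cancels one factor of the square.\<close>
  also have "\<dots> = exp (- 2 * real (card I) * \<delta>\<^sup>2)"
    using card by (simp add: power2_eq_square)
  finally show ?thesis by (simp add: sumZ)
qed

end

section \<open>Path maxima, null quantile and template\<close>

lemma measurable_Max_path:
  "(\<lambda>x. Max (x ` {0..T})) \<in> borel_measurable (path_space T)"
  unfolding path_space_def
  by (rule borel_measurable_Max_image[where f = "\<lambda>t x. x t", simplified]) auto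

text \<open>Makes the path maximum a function of the restricted path, so that equality of laws and
  independence pass from paths to their maxima.\<close>

lemma path_max_eq: "path_max T M \<omega> = Max (path T M \<omega> ` {0..T})"
  unfolding path_max_def path_def by (auto intro!: arg_cong[where f = Max] image_cong)

lemma measurable_path_e_process:
  assumes "e_process P0 F T M"
  shows "path T M \<in> P0 \<rightarrow>\<^sub>M path_space T"
proof -
  have "M t \<in> borel_measurable P0" if "t \<in> {0..T}" for t
    using assms that measurable_from_subalg[of P0 "F t" "M t" borel]
    by (auto simp: e_process_def)
  then show ?thesis
    unfolding path_space_def path_def by (intro measurable_restrict) auto
qed

lemma null_quantile_nonneg:
  assumes "e_process P0 F T M" "0 < \<gamma>"
  shows "0 \<le> null_quantile P0 T M \<gamma>"
proof -
  interpret prob_space P0 using assms by (simp add: e_process_def)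
  have "path_max T M \<in> borel_measurable P0"
    using measurable_compose[OF measurable_path_e_process[OF assms(1)] measurable_Max_path]
    by (simp add: path_max_eq[abs_def])
  from ex_prob_upper_tail_le[OF this assms(2)] show ?thesis
    unfolding null_quantile_def by (intro cInf_greatest) auto
qed

lemma measure_path_max_greater_null_quantile:
  assumes "e_process P0 F T M" "0 < \<gamma>"
  shows "measure P0 {\<omega> \<in> space P0. null_quantile P0 T M \<gamma> < path_max T M \<omega>} \<le> \<gamma>"
proof -
  interpret prob_space P0 using assms by (simp add: e_process_def)
  have "path_max T M \<in> borel_measurable P0"
    using measurable_compose[OF measurable_path_e_process[OF assms(1)] measurable_Max_path]
    by (simp add: path_max_eq[abs_def])
  from prob_greater_Inf_upper_tail_le[OF this assms(2)] show ?thesis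
    unfolding null_quantile_def .
qed

text \<open>Goes through the extremes: \<open>g t\<close> is at most the maximum, and
  \<open>g u\<close> is at least the minimum.\<close>

lemma aspect_ratio_bound:
  assumes "\<And>t. t \<le> T \<Longrightarrow> 0 < g t" "t \<le> T" "u \<le> T"
  shows "g t \<le> aspect_ratio T g * g u"
proof -
  have Min: "0 < Min (g ` {0..T})" "Min (g ` {0..T}) \<le> g u"
    and Max: "g t \<le> Max (g ` {0..T})"
    using assms by auto
  have "g t \<le> Max (g ` {0..T}) * 1"
    using Max by simp
  also have "\<dots> \<le> Max (g ` {0..T}) * (g u / Min (g ` {0..T}))"
    using Min Max assms(1)[OF assms(2)] by (intro mult_left_mono) auto
  finally show ?thesis by (simp add: aspect_ratio_def)
qed

lemma calib_index_pos: "\<alpha> < 1 \<Longrightarrow> 0 < calib_index \<alpha> B"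
  by (simp add: calib_index_def)

lemma calib_index_less:
  assumes "\<alpha> < 1"
  shows "real (calib_index \<alpha> B) < (1 - \<alpha>) * (real B + 1) + 1"
proof -
  \<comment> \<open>Nonnegativity keeps \<open>nat\<close> from truncating, so only the ceiling
    separates the two sides.\<close>
  have "0 \<le> (1 - \<alpha>) * (real B + 1)"
    using assms by simp
  then show ?thesis
    unfolding calib_index_def by linarith
qed

section \<open>Calibration in the case of a positive exponent\<close>

text \<open>\<open>\<eta>_greater\<close> restricts to the case where the positive part in the
  exponent is positive; otherwise the claimed bound is \<open>0\<close>.\<close>

locale calibration =
  fixes P0 :: "'a measure" and F :: "nat \<Rightarrow> 'a measure"
    and M :: "nat \<Rightarrow> 'a \<Rightarrow> real"
    and P :: "'b measure" and X :: "nat \<Rightarrow> nat \<Rightarrow> 'b \<Rightarrow> real"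
    and T B :: nat and g :: "nat \<Rightarrow> real" and \<alpha> \<eta> :: real
  assumes e_process: "e_process P0 F T M"
    and B_pos: "1 \<le> B"
    and reference: "reference_trajectories P0 T M P B X"
    and g_pos: "\<And>t. t \<le> T \<Longrightarrow> 0 < g t"
    and \<alpha>_less: "\<alpha> < 1"
    and \<eta>_less: "\<eta> < \<alpha>"
    and \<eta>_greater: "(1 - \<alpha>) / real B < \<eta>"
begin

sublocale P: prob_space P
  using reference by (simp add: reference_trajectories_def)

lemma measurable_path_X:
  assumes "b \<in> {1..B}"
  shows "path T (X b) \<in> P \<rightarrow>\<^sub>M path_space T"
  using reference assms by (auto simp: reference_trajectories_def P.indep_vars_def)

text \<open>The maximum is a measurable function of the path, and the paths have equal laws. A
  general \<open>A\<close> serves both closed and open tails.\<close>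

lemma measure_path_max_X:
  assumes "b \<in> {1..B}" and [measurable]: "A \<in> sets borel"
  shows "P.prob {\<omega> \<in> space P. path_max T (X b) \<omega> \<in> A}
       = measure P0 {\<omega> \<in> space P0. path_max T M \<omega> \<in> A}"
proof -
  let ?m = "\<lambda>x. Max (x ` {0..T})"
  note [measurable] = measurable_Max_path
  have S: "?m -` A \<inter> space (path_space T) \<in> sets (path_space T)"
    by measurable
  note X = measurable_path_X[OF assms(1)] and M = measurable_path_e_process[OF e_process]
  have "P.prob {\<omega> \<in> space P. path_max T (X b) \<omega> \<in> A}
      = measure (distr P (path_space T) (path T (X b))) (?m -` A \<inter> space (path_space T))"
    using measurable_space[OF X]
    by (subst measure_distr[OF X S]) (auto simp: path_max_eq intro!: arg_cong[where f = P.prob])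
  also have "\<dots> = measure (distr P0 (path_space T) (path T M)) (?m -` A \<inter> space (path_space T))"
    using reference assms(1) by (simp add: reference_trajectories_def)
  also have "\<dots> = measure P0 {\<omega> \<in> space P0. path_max T M \<omega> \<in> A}"
    using measurable_space[OF M]
    by (subst measure_distr[OF M S]) (auto simp: path_max_eq intro!: arg_cong[where f = "measure P0"])
  finally show ?thesis .
qed

abbreviation "k \<equiv> calib_index \<alpha> B"

text \<open>From \<open>1 - \<alpha> < real B * \<alpha>\<close> it follows that
  \<open>(1 - \<alpha>) * (real B + 1) < real B\<close>. Hence the order statistic is a genuine
  sample value and not the conventional \<open>\<infinity>\<close>.\<close>

lemma k_le: "k \<le> B"
proof -
  have "1 - \<alpha> < real B * \<eta>"
    using \<eta>_greater B_pos by (simp add: pos_divide_less_eq mult.commute)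
  also have "\<dots> \<le> real B * \<alpha>"
    using \<eta>_less by (intro mult_left_mono) auto
  finally have "1 - \<alpha> < real B * \<alpha>" .
  then have "real k < real B + 1"
    using calib_index_less[OF \<alpha>_less, of B] by (simp add: algebra_simps)
  then show ?thesis by linarith
qed

text \<open>Hoeffding's inequality with the deviation \<open>?\<delta>\<close> chosen so that
  \<open>real B * (\<alpha> - \<eta> + ?\<delta>)\<close> equals
  \<open>real B * \<alpha> - (1 - \<alpha>)\<close>, which is below
  \<open>B - k + 1\<close>.\<close>

lemma prob_card_upper_tail:
  assumes [measurable]: "A \<in> sets borel"
    and tail: "measure P0 {\<omega> \<in> space P0. path_max T M \<omega> \<in> A} \<le> \<alpha> - \<eta>"
  shows "1 - exp (- 2 * real B * (max (\<eta> - (1 - \<alpha>) / real B) 0)\<^sup>2)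
           \<le> P.prob {\<omega> \<in> space P. card {b \<in> {1..B}. path_max T (X b) \<omega> \<in> A} \<le> B - k}"
proof -
  let ?\<delta> = "\<eta> - (1 - \<alpha>) / real B"
  let ?N = "\<lambda>\<omega>. card {b \<in> {1..B}. path_max T (X b) \<omega> \<in> A}"
  let ?E = "{\<omega> \<in> space P. real B * (\<alpha> - \<eta> + ?\<delta>) \<le> real (?N \<omega>)}"
  have "P.indep_vars (\<lambda>_. path_space T) (\<lambda>b. path T (X b)) {1..B}"
    using reference by (simp add: reference_trajectories_def)
  from P.indep_vars_compose2[OF this measurable_Max_path]
  have indep: "P.indep_vars (\<lambda>_. borel) (\<lambda>b. path_max T (X b)) {1..B}"
    by (simp add: path_max_eq[abs_def])
  then have [measurable]: "b \<in> {1..B} \<Longrightarrow> path_max T (X b) \<in> borel_measurable P" for b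
    by (auto simp: P.indep_vars_def)
  have "P.prob {\<omega> \<in> space P. real (card {1..B}) * (\<alpha> - \<eta> + ?\<delta>) \<le> real (?N \<omega>)}
      \<le> exp (- 2 * real (card {1..B}) * ?\<delta>\<^sup>2)"
    using \<eta>_greater B_pos tail indep
    by (intro P.Hoeffding_card_ge) (auto simp: measure_path_max_X)
  then have le: "P.prob ?E \<le> exp (- 2 * real B * ?\<delta>\<^sup>2)"
    by simp
  have "real (?N \<omega>) = (\<Sum>b\<in>{1..B}. indicator A (path_max T (X b) \<omega>))" for \<omega>
    by (simp add: indicator_def sum.If_cases Int_def)
  then have N: "(\<lambda>\<omega>. real (?N \<omega>)) \<in> borel_measurable P"
    by (simp only:) measurable
  have E: "?E \<in> sets P"
    using N by measurable
  have "?N \<omega> \<le> B - k" if "\<omega> \<in> space P - ?E" for \<omega>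
  proof -
    have "real (?N \<omega>) < real B * (\<alpha> - \<eta> + ?\<delta>)"
      using that by auto
    also have "\<dots> = real B * \<alpha> - (1 - \<alpha>)"
      using B_pos by (simp add: field_simps)
    also have "\<dots> < real B - real k + 1"
      using calib_index_less[OF \<alpha>_less, of B] by (simp add: algebra_simps)
    \<comment> \<open>The count is an integer below \<open>B - k + 1\<close>; \<open>k_le\<close>
      makes the natural subtraction \<open>B - k\<close> exact.\<close>
    finally show ?thesis using k_le by linarith
  qed
  moreover have "{\<omega> \<in> space P. ?N \<omega> \<le> B - k} \<in> sets P"
  proof -
    have "{\<omega> \<in> space P. real (?N \<omega>) \<le> real (B - k)} \<in> sets P"
      using N by measurable
    then show ?thesis by (simp only: of_nat_le_iff)
  qed
  ultimately have "P.prob (space P - ?E) \<le> P.prob {\<omega> \<in> space P. ?N \<omega> \<le> B - k}"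
    by (intro P.finite_measure_mono) auto
  moreover have "max ?\<delta> 0 = ?\<delta>"
    using \<eta>_greater by simp
  ultimately show ?thesis
    using le P.prob_compl[OF E] by simp
qed

text \<open>The calibrated multiplier as a real number, which is legitimate because
  \<open>k \<le> B\<close>. Lists are indexed from \<open>0\<close>, hence
  \<open>k - 1\<close>.\<close>

definition R_k :: "'b \<Rightarrow> real" where
  "R_k \<omega> = sort (map (\<lambda>b. normalized_max T g X b \<omega>) [1..<Suc B]) ! (k - 1)"

definition boundary :: "'b \<Rightarrow> real" where
  "boundary \<omega> = Max ((\<lambda>t. R_k \<omega> * g t) ` {0..T})"

text \<open>The embedding \<open>ereal\<close> is monotone and so commutes with \<open>Max\<close>;
  the remaining estimates can stay in the reals.\<close>

lemma max_calib_boundary_eq: "max_calib_boundary \<alpha> T B g X \<omega> = ereal (boundary \<omega>)"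
proof -
  have "max_calib_boundary \<alpha> T B g X \<omega> = Max (ereal ` (\<lambda>t. R_k \<omega> * g t) ` {0..T})"
    using k_le by (simp add: max_calib_boundary_def calib_mult_def order_stat_def R_k_def image_image
        del: upt_Suc)
  also have "\<dots> = ereal (boundary \<omega>)"
    unfolding boundary_def by (intro mono_Max_commute[symmetric]) (auto simp: mono_def)
  finally show ?thesis .
qed

lemma borel_measurable_boundary: "boundary \<in> borel_measurable P"
proof -
  have "normalized_max T g X b \<in> borel_measurable P" if "b \<in> {1..B}" for b
  proof -
    have "X b t \<in> borel_measurable P" if "t \<in> {0..T}" for t
    proof -
      have "(\<lambda>x. x t) \<in> borel_measurable (path_space T)"
        using that unfolding path_space_def by measurable
      from measurable_compose[OF measurable_path_X[OF \<open>b \<in> {1..B}\<close>] this] that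
      show ?thesis by (simp add: path_def)
    qed
    then show ?thesis
      unfolding normalized_max_def[abs_def] by (intro borel_measurable_Max_image) auto
  qed
  then have "R_k \<in> borel_measurable P"
    unfolding R_k_def[abs_def]
    by (intro borel_measurable_sort_nth calib_index_pos k_le) (auto simp: \<alpha>_less)
  then show ?thesis
    unfolding boundary_def[abs_def] by (intro borel_measurable_Max_image) auto
qed

text \<open>Pigeonhole: at most \<open>k - 1\<close> trajectories lie strictly below the
  \<open>k\<close>-th smallest value and at most \<open>B - k\<close> have path maximum in
  \<open>A\<close>, which leaves at least one of the \<open>B\<close> trajectories.\<close>

lemma ex_normalized_max_ge_if_few:
  assumes up: "\<And>x y. x \<le> y \<Longrightarrow> x \<in> A \<Longrightarrow> y \<in> A"
    and few: "card {b \<in> {1..B}. path_max T (X b) \<omega> \<in> A} \<le> B - k"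
  shows "\<exists>b\<in>{1..B}. R_k \<omega> \<le> normalized_max T g X b \<omega> \<and> path_max T (X b) \<omega> \<notin> A"
proof (rule ccontr)
  let ?R = "\<lambda>b. normalized_max T g X b \<omega>"
  assume none: "\<not> ?thesis"
  \<comment> \<open>For \<open>Q\<close> being \<open>x < R_k \<omega>\<close>, the left side of the
    counting equivalence is \<open>R_k \<omega> < R_k \<omega>\<close>, which is false.\<close>
  have "\<not> k \<le> card {b \<in> {1..B}. ?R b < R_k \<omega>}"
    using sort_nth_iff_card[OF calib_index_pos[OF \<alpha>_less] k_le, of "\<lambda>x. x < R_k \<omega>" ?R]
    unfolding R_k_def[symmetric] by auto
  moreover have "{1..B} \<subseteq> {b \<in> {1..B}. ?R b < R_k \<omega>} \<union> {b \<in> {1..B}. path_max T (X b) \<omega> \<in> A}"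
    using none by (auto simp: not_le)
  then have "card {1..B} \<le> card {b \<in> {1..B}. ?R b < R_k \<omega>} + card {b \<in> {1..B}. path_max T (X b) \<omega> \<in> A}"
    by (intro order_trans[OF card_mono card_Un_le]) auto
  ultimately show False using few k_le by simp
qed

lemma aspect_ratio_pos: "0 < aspect_ratio T g"
  using aspect_ratio_bound[of T g 0 0] g_pos[of 0] g_pos
  by (metis le0 mult_le_0_iff not_less order_less_le_trans zero_less_mult_pos2)

text \<open>Compares the time \<open>t\<close> where the boundary is largest with the time
  \<open>u\<close> where the normalized path is largest. Reference paths are nonnegative only almost
  surely, so the sign of \<open>R_k \<omega>\<close> is drawn from
  \<open>0 \<le> boundary \<omega>\<close>.\<close>

lemma boundary_le:
  assumes "R_k \<omega> \<le> normalized_max T g X b \<omega>" "0 \<le> boundary \<omega>"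
  shows "boundary \<omega> \<le> aspect_ratio T g * path_max T (X b) \<omega>"
proof -
  have "boundary \<omega> \<in> (\<lambda>t. R_k \<omega> * g t) ` {0..T}"
    unfolding boundary_def by (intro Max_in) auto
  then obtain t where t: "t \<le> T" "boundary \<omega> = R_k \<omega> * g t" by auto
  have "normalized_max T g X b \<omega> \<in> (\<lambda>t. X b t \<omega> / g t) ` {0..T}"
    unfolding normalized_max_def by (intro Max_in) auto
  then obtain u where u: "u \<le> T" "normalized_max T g X b \<omega> = X b u \<omega> / g u" by auto
  have R_k: "0 \<le> R_k \<omega>" "R_k \<omega> * g u \<le> X b u \<omega>"
    using assms t u g_pos[OF t(1)] g_pos[OF u(1)] by (auto simp: zero_le_mult_iff field_simps)
  have "boundary \<omega> \<le> R_k \<omega> * (aspect_ratio T g * g u)"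
    unfolding t(2) using R_k aspect_ratio_bound[OF g_pos t(1) u(1)] by (intro mult_left_mono)
  also have "\<dots> = aspect_ratio T g * (R_k \<omega> * g u)"
    by simp
  also have "\<dots> \<le> aspect_ratio T g * path_max T (X b) \<omega>"
  proof (intro mult_left_mono)
    have "X b u \<omega> \<le> path_max T (X b) \<omega>"
      unfolding path_max_def using u(1) by (intro Max_ge) auto
    with R_k(2) show "R_k \<omega> * g u \<le> path_max T (X b) \<omega>" by simp
  qed (use aspect_ratio_pos in simp)
  finally show ?thesis .
qed

text \<open>One statement for both claims: \<open>A\<close> is a closed or open upper tail, and
  \<open>C\<close> is the matching open or closed lower ray. The condition on negative
  \<open>c\<close> covers the paths to which \<open>boundary_le\<close> does not apply.\<close>

lemma prob_boundary:
  assumes A: "A \<in> sets borel" "\<And>x y. x \<le> y \<Longrightarrow> x \<in> A \<Longrightarrow> y \<in> A"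
    and tail: "measure P0 {\<omega> \<in> space P0. path_max T M \<omega> \<in> A} \<le> \<alpha> - \<eta>"
    and C: "C \<in> sets borel" "\<And>c. c < 0 \<Longrightarrow> c \<in> C"
      "\<And>c x. x \<notin> A \<Longrightarrow> c \<le> aspect_ratio T g * x \<Longrightarrow> c \<in> C"
  shows "1 - exp (- 2 * real B * (max (\<eta> - (1 - \<alpha>) / real B) 0)\<^sup>2)
           \<le> P.prob {\<omega> \<in> space P. boundary \<omega> \<in> C}"
proof -
  have "boundary \<omega> \<in> C" if few: "card {b \<in> {1..B}. path_max T (X b) \<omega> \<in> A} \<le> B - k" for \<omega>
  proof (cases "boundary \<omega> < 0")
    case False
    then show ?thesis
      using ex_normalized_max_ge_if_few[OF A(2) few] boundary_le C(3) by fastforce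
  qed (rule C(2))
  then have "P.prob {\<omega> \<in> space P. card {b \<in> {1..B}. path_max T (X b) \<omega> \<in> A} \<le> B - k}
      \<le> P.prob {\<omega> \<in> space P. boundary \<omega> \<in> C}"
    using borel_measurable_boundary C(1) by (intro P.finite_measure_mono) auto
  with prob_card_upper_tail[OF A(1) tail] show ?thesis
    by simp
qed

end

theorem theorem2p4:
  fixes P0 :: "'a measure" and F :: "nat \<Rightarrow> 'a measure"
    and M :: "nat \<Rightarrow> 'a \<Rightarrow> real"
    and P :: "'b measure" and X :: "nat \<Rightarrow> nat \<Rightarrow> 'b \<Rightarrow> real"
    and T B :: nat and g :: "nat \<Rightarrow> real" and \<alpha> \<eta> :: real
  assumes "e_process P0 F T M"
    and "1 \<le> B"
    and "reference_trajectories P0 T M P B X"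
    and "\<And>t. t \<le> T \<Longrightarrow> 0 < g t"
    and "0 < \<alpha>" "\<alpha> < 1"
    and "0 < \<eta>" "0 < \<alpha> - \<eta>"
  shows
    "(measure P0 {\<omega> \<in> space P0. path_max T M \<omega> \<ge> null_quantile P0 T M (\<alpha> - \<eta>)} \<le> \<alpha> - \<eta>
        \<longrightarrow> measure P {\<omega> \<in> space P. max_calib_boundary \<alpha> T B g X \<omega>
                          < ereal (aspect_ratio T g * null_quantile P0 T M (\<alpha> - \<eta>))}
            \<ge> 1 - exp (- 2 * real B * (max (\<eta> - (1 - \<alpha>) / real B) 0)\<^sup>2))
     \<and> measure P {\<omega> \<in> space P. max_calib_boundary \<alpha> T B g X \<omega> / ereal (1 / \<alpha>)
                          \<le> ereal (\<alpha> * aspect_ratio T g * null_quantile P0 T M (\<alpha> - \<eta>))}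
         \<ge> 1 - exp (- 2 * real B * (max (\<eta> - (1 - \<alpha>) / real B) 0)\<^sup>2)"
proof (cases "(1 - \<alpha>) / real B < \<eta>")
  case False
  \<comment> \<open>The claimed lower bound becomes \<open>1 - exp 0 = 0\<close>.\<close>
  then have "max (\<eta> - (1 - \<alpha>) / real B) 0 = 0"
    by simp
  then show ?thesis
    by simp
next
  case True
  interpret calibration P0 F M P X T B g \<alpha> \<eta>
    by unfold_locales (use assms True in auto)
  let ?s = "null_quantile P0 T M (\<alpha> - \<eta>)"
  let ?p = "1 - exp (- 2 * real B * (max (\<eta> - (1 - \<alpha>) / real B) 0)\<^sup>2)"
  have Ks: "0 \<le> aspect_ratio T g * ?s"
    using null_quantile_nonneg[OF assms(1,8)] aspect_ratio_pos by simp
  note K = aspect_ratio_pos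
  \<comment> \<open>Outside the closed tail the path maximum is strictly below \<open>?s\<close>,
    and the positive aspect ratio preserves strictness.\<close>
  have "?p \<le> P.prob {\<omega> \<in> space P. boundary \<omega> \<in> {..<aspect_ratio T g * ?s}}"
    if "measure P0 {\<omega> \<in> space P0. path_max T M \<omega> \<ge> ?s} \<le> \<alpha> - \<eta>"
    by (rule prob_boundary[where A = "{?s..}"])
       (use that Ks K in \<open>auto intro: le_less_trans\<close>)
  \<comment> \<open>The open tail has mass at most \<open>\<alpha> - \<eta>\<close> even when the
    infimum is not attained, at the price of a weak inequality for the boundary.\<close>
  moreover have "?p \<le> P.prob {\<omega> \<in> space P. boundary \<omega> \<in> {..aspect_ratio T g * ?s}}"
    by (rule prob_boundary[where A = "{?s<..}"])
       (use measure_path_max_greater_null_quantile[OF assms(1,8)] Ks K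
        in \<open>auto intro: order_trans mult_left_mono\<close>)
  \<comment> \<open>Dividing by \<open>1 / \<alpha>\<close> multiplies by the positive
    \<open>\<alpha>\<close>, which cancels on both sides.\<close>
  moreover have "max_calib_boundary \<alpha> T B g X \<omega> / ereal (1 / \<alpha>) \<le> ereal (\<alpha> * aspect_ratio T g * ?s)
      \<longleftrightarrow> boundary \<omega> \<in> {..aspect_ratio T g * ?s}" for \<omega>
    using assms(5) by (simp add: max_calib_boundary_eq mult.assoc mult.commute[of _ \<alpha>])
  ultimately show ?thesis
    by (simp add: max_calib_boundary_eq)
qed

end
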